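(* Let $A$ be a finite alphabet, let $\mathcal V$ be an lp-variety of languages, and let $\mathcal D\subseteq\mathcal P((A\times 2)^* )$ be a Boolean subalgebra closed under quotients such that $A^*\otimes\mathbb N\in\mathcal D$ and $\{L\cap A_z: L\in\mathcal D\}=\{\emptyset,A_z\}$. With $\mathcal D_0,\mathcal D_1,M,T,\eta$, the semidirect product $\eta[T^*]{**}M$ and $\tau_{\mathcal D_1}$ as in the context, let $h\colon A^*\to\eta[T^*]{**}M$ be the monoid homomorphism with $h(a)=(\eta(t_a),m_a)$ for $a\in A$, where $t_a\in T$ is the class of the one-letter marked word $(a,1)$ and $m_a=[a]\in M$. Let $p\colon\eta[T^*]{**}M\hookrightarrow X_{\mathcal V(X_{\mathcal D_1})}\times X_{\mathcal D_0}$ be the inclusion. Then a language $L\subseteq A^*$ is of the form $L=(p\circ h)^{-1}(C)$ for some clopen $C\subseteq X_{\mathcal V(X_{\mathcal D_1})}\times X_{\mathcal D_0}$ (i.e. $L$ is recognized by the Boolean space with internal monoid $\eta[T^*]{**}M\hookrightarrow X_{\mathcal V(X_{\mathcal D_1})}\times X_{\mathcal D_0}$ via $h$) if and only if $L$ is a lattice combination (finite union of finite intersections) of languages belonging to $(\mathcal V(X_{\mathcal D_1})\odot\mathcal D_1)\cup\mathcal D_0$.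
   Context: Languages, quotients: for a monoid $S$ and $L\subseteq S$, $u^{-1}L=\{v: uv\in L\}$, $Lu^{-1}=\{v:vu\in L\}$; a set of languages is closed under quotients if closed under $L\mapsto u^{-1}Lv^{-1}$. For a Boolean algebra $\mathcal B$, $X_{\mathcal B}$ is its Stone dual space of ultrafilters. An lp-variety $\mathcal V$ assigns to each finite alphabet $B$ a Boolean algebra $\mathcal V(B)\subseteq\mathcal P(B^* )$ closed under quotients such that $(f^* )^{-1}(K)\in\mathcal V(B')$ for every $K\in\mathcal V(B)$ and every map $f\colon B'\to B$ between finite alphabets ($f^*$ the length-preserving homomorphism extending $f$). For a profinite (Boolean) space $Y$, $Y^*$ is the topological sum of the product spaces $Y^n$, $n\ge0$, and $\mathcal V(Y)$ is the set of languages $(g^* )^{-1}(K)\subseteq Y^*$ with $g\colon Y\to B$ a continuous surjection onto a finite discrete set and $K\in\mathcal V(B)$; it is a Boolean algebra of clopen subsets of $Y^*$ closed under quotients by words of $Y^*$. Marked words: $A^*\otimes\mathbb N=\{(w,i): w\in A^*, 1\le i\le|w|\}$, identified with the words over $A\times 2$ having exactly one letter in $A\times\{1\}$ (the $i$-th); $A^*$ is identified with $(A\times\{0\})^*$; $A_z=(A\times2)^*\setminus(A^*\cup A^*\otimes\mathbb N)$. Put $\mathcal D_0=\{L\cap A^*:L\in\mathcal D\}$, $\mathcal D_1=\{L\cap(A^*\otimes\mathbb N):L\in\mathcal D\}$. Setting: for $u\in A^*$ let $[u]=\{L\in\mathcal D_0:u\in L\}\in X_{\mathcal D_0}$ and $M=\{[u]:u\in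 A^*\}$, a monoid with $[u][v]=[uv]$ (dense in $X_{\mathcal D_0}$). For $(w,i)\in A^*\otimes\mathbb N$ let $[(w,i)]=\{L\in\mathcal D_1:(w,i)\in L\}$ and $T=\{[(w,i)]\}\subseteq X_{\mathcal D_1}$. For $m=[u]\in M$ and $j\in\{0,1\}$, $\lambda_m,\rho_m\colon X_{\mathcal D_j}\to X_{\mathcal D_j}$ are $\lambda_m(x)=\{L\in\mathcal D_j: u^{-1}L\in x\}$, $\rho_m(x)=\{L\in\mathcal D_j:Lu^{-1}\in x\}$; for $t=[(w,i)]\in T$, $\lambda_t,\rho_t\colon X_{\mathcal D_0}\to X_{\mathcal D_1}$ are $\lambda_t(x)=\{L\in\mathcal D_1:(w,i)^{-1}L\in x\}$, $\rho_t(x)=\{L\in\mathcal D_1:L(w,i)^{-1}\in x\}$ (concatenation in $(A\times2)^*$). These are well defined, continuous, depend only on $m$, $t$, and $\lambda_m,\rho_m$ give a biaction of $M$ preserving $T$. $M$ biacts on $X_{\mathcal D_1}^*$ letterwise: $\lambda_m^*(x_1\cdots x_k)=\lambda_m(x_1)\cdots\lambda_m(x_k)$, similarly $\rho_m^*$. Let $\eta\colon X_{\mathcal D_1}^*\to X_{\mathcal V(X_{\mathcal D_1})}$, $\eta(\underline x)=\{K\in\mathcal V(X_{\mathcal D_1}):\underline x\in K\}$; $\eta[T^*]$ is a monoid with $\eta(\underline x)\eta(\underline y)=\eta(\underline x\underline y)$, and $\eta[T^*]{**}M$ denotes the set $\eta[T^*]\times M$ with multiplication $(\eta(\underline x),m)(\eta(\underline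 x'),m')=(\eta(\rho_{m'}^*(\underline x)\lambda_m^*(\underline x')),mm')$. Finally $\tau_{\mathcal D_1}\colon A^*\to X_{\mathcal D_1}^*$, $\tau_{\mathcal D_1}(w)=[(w,1)]\cdots[(w,|w|)]$, and $\mathcal V(X_{\mathcal D_1})\odot\mathcal D_1=\{\tau_{\mathcal D_1}^{-1}(K):K\in\mathcal V(X_{\mathcal D_1})\}$. *)

theory Defs
  imports "HOL-Analysis.Analysis" "HOL-Algebra.Group"
begin

section \<open>Languages and lp-varieties\<close>

definition lquot :: "'c list \<Rightarrow> 'c list set \<Rightarrow> 'c list set" where
  "lquot u L = {v. u @ v \<in> L}"

definition rquot :: "'c list set \<Rightarrow> 'c list \<Rightarrow> 'c list set" where
  "rquot L u = {v. v @ u \<in> L}"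

definition closed_under_quotients :: "'c set \<Rightarrow> 'c list set set \<Rightarrow> bool" where
  "closed_under_quotients S \<B> \<longleftrightarrow>
     (\<forall>L\<in>\<B>. \<forall>u\<in>lists S. \<forall>v\<in>lists S. rquot (lquot u L) v \<in> \<B>)"

definition quotient_algebra :: "'c set \<Rightarrow> 'c list set set \<Rightarrow> bool" where
  "quotient_algebra S \<B> \<longleftrightarrow> algebra (lists S) \<B> \<and> closed_under_quotients S \<B>"

text \<open>
  HOL cannot quantify over all finite types inside a formula, so the finite alphabets range over
  the finite sets of natural numbers.  Every finite set is in bijection with one of
  these, and \<open>\<V>\<close> is determined up to renaming of letters: the condition on inverse images applies
  in particular to bijections.
\<close>

definition lp_variety :: "(nat set \<Rightarrow> nat list set set) \<Rightarrow> bool" where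
  "lp_variety \<V> \<longleftrightarrow>
     (\<forall>B. finite B \<longrightarrow> quotient_algebra B (\<V> B)) \<and>
     (\<forall>B B' f. finite B \<longrightarrow> finite B' \<longrightarrow> f ` B' \<subseteq> B \<longrightarrow>
        (\<forall>K\<in>\<V> B. {w \<in> lists B'. map f w \<in> K} \<in> \<V> B'))"


section \<open>Stone duality\<close>

text \<open>
  The top element of a Boolean algebra \<open>\<B>\<close> of sets is \<open>\<Union>\<B>\<close>, so the underlying set need not be a
  parameter.
\<close>

definition ultrafilters :: "'s set set \<Rightarrow> 's set set set" where
  "ultrafilters \<B> =
     {x. x \<subseteq> \<B> \<and> \<Union>\<B> \<in> x \<and> {} \<notin> x \<and>
         (\<forall>K\<in>x. \<forall>L\<in>x. K \<inter> L \<in> x) \<and>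
         (\<forall>K\<in>x. \<forall>L\<in>\<B>. K \<subseteq> L \<longrightarrow> L \<in> x) \<and>
         (\<forall>L\<in>\<B>. L \<in> x \<or> \<Union>\<B> - L \<in> x)}"

definition stone :: "'s set set \<Rightarrow> 's set set topology" where
  "stone \<B> = topology_generated_by {{x \<in> ultrafilters \<B>. L \<in> x} | L. L \<in> \<B>}"

text \<open>The classes \<open>[u]\<close> and \<open>[(w, i)]\<close> and the map \<open>\<eta>\<close> are all instances of the class of a point,
  that is, of the principal ultrafilter at that point.\<close>

definition point_class :: "'s set set \<Rightarrow> 's \<Rightarrow> 's set set" where
  "point_class \<B> s = {L \<in> \<B>. s \<in> L}"

lemma topspace_stone:
  assumes "algebra \<Omega> \<B>"
  shows "topspace (stone \<B>) = ultrafilters \<B>"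
proof -
  interpret algebra \<Omega> \<B> by fact
  have "\<Union>\<B> = \<Omega>" using space_closed top by blast
  then show ?thesis
    using top by (auto simp: stone_def topology_generated_by_topspace ultrafilters_def)
qed

lemma point_class_in_ultrafilters:
  assumes "algebra \<Omega> \<B>" "s \<in> \<Omega>"
  shows "point_class \<B> s \<in> ultrafilters \<B>"
proof -
  interpret algebra \<Omega> \<B> by fact
  have "\<Union>\<B> = \<Omega>" using space_closed top by blast
  then show ?thesis
    using assms(2) top compl_sets by (auto simp: ultrafilters_def point_class_def)
qed

text \<open>The extension of an lp-variety to a Boolean space \<open>Y\<close>; words over \<open>Y\<close> are lists of points.\<close>

definition ext_variety :: "(nat set \<Rightarrow> nat list set set) \<Rightarrow> 'y topology \<Rightarrow> 'y list set set" where
  "ext_variety \<V> Y =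
     {{x \<in> lists (topspace Y). map g x \<in> K} | g B K.
        finite B \<and> continuous_map Y (discrete_topology B) g \<and> g ` topspace Y = B \<and> K \<in> \<V> B}"


section \<open>Marked words\<close>

text \<open>
  The alphabet \<open>A \<times> 2\<close> is \<open>A \<times> UNIV\<close> with the second component of type \<^typ>\<open>bool\<close>: \<open>True\<close> is the mark.
  The map \<open>plain\<close> identifies \<open>A\<^sup>*\<close> with the words over \<open>A \<times> {0}\<close>, and \<open>mark w i\<close> is the
  marked word \<open>(w, i)\<close>, where positions are counted from 1.
\<close>

definition plain :: "'a list \<Rightarrow> ('a \<times> bool) list" where
  "plain u = map (\<lambda>a. (a, False)) u"

definition mark :: "'a list \<Rightarrow> nat \<Rightarrow> ('a \<times> bool) list" where
  "mark w i = plain (take (i - 1) w) @ [(w ! (i - 1), True)] @ plain (drop i w)"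

definition marked :: "'a set \<Rightarrow> ('a \<times> bool) list set" where
  "marked A = {mark w i | w i. w \<in> lists A \<and> 1 \<le> i \<and> i \<le> length w}"

definition Az :: "'a set \<Rightarrow> ('a \<times> bool) list set" where
  "Az A = lists (A \<times> UNIV) - (plain ` lists A \<union> marked A)"

text \<open>\<open>D0\<close> consists of languages over \<open>A\<close> itself, via the identification \<open>plain\<close>.\<close>

definition D0 :: "'a set \<Rightarrow> ('a \<times> bool) list set set \<Rightarrow> 'a list set set" where
  "D0 A \<D> = {{u \<in> lists A. plain u \<in> L} | L. L \<in> \<D>}"

definition D1 :: "'a set \<Rightarrow> ('a \<times> bool) list set set \<Rightarrow> ('a \<times> bool) list set set" where
  "D1 A \<D> = {L \<inter> marked A | L. L \<in> \<D>}"


section \<open>The semidirect product\<close>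

definition M_set :: "'a set \<Rightarrow> ('a \<times> bool) list set set \<Rightarrow> 'a list set set set" where
  "M_set A \<D> = point_class (D0 A \<D>) ` lists A"

definition T_set :: "'a set \<Rightarrow> ('a \<times> bool) list set set \<Rightarrow> ('a \<times> bool) list set set set" where
  "T_set A \<D> = point_class (D1 A \<D>) ` marked A"

text \<open>
  The operations below are given on representatives.  \<open>THE\<close> picks the value common to all
  representatives, and so expresses the definition together with the claim that it is well defined.
\<close>

definition mult_M ::
  "'a set \<Rightarrow> ('a \<times> bool) list set set \<Rightarrow> 'a list set set \<Rightarrow> 'a list set set \<Rightarrow> 'a list set set" where
  "mult_M A \<D> m m' =
     (THE n. \<exists>u\<in>lists A. \<exists>v\<in>lists A.
        m = point_class (D0 A \<D>) u \<and> m' = point_class (D0 A \<D>) v \<and> n = point_class (D0 A \<D>) (u @ v))"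

definition lam :: "'a set \<Rightarrow> ('a \<times> bool) list set set \<Rightarrow> 'a list set set \<Rightarrow>
    ('a \<times> bool) list set set \<Rightarrow> ('a \<times> bool) list set set" where
  "lam A \<D> m x =
     (THE y. \<exists>u\<in>lists A. m = point_class (D0 A \<D>) u \<and> y = {L \<in> D1 A \<D>. lquot (plain u) L \<in> x})"

definition rho :: "'a set \<Rightarrow> ('a \<times> bool) list set set \<Rightarrow> 'a list set set \<Rightarrow>
    ('a \<times> bool) list set set \<Rightarrow> ('a \<times> bool) list set set" where
  "rho A \<D> m x =
     (THE y. \<exists>u\<in>lists A. m = point_class (D0 A \<D>) u \<and> y = {L \<in> D1 A \<D>. rquot L (plain u) \<in> x})"

definition eta :: "(nat set \<Rightarrow> nat list set set) \<Rightarrow> 'a set \<Rightarrow> ('a \<times> bool) list set set \<Rightarrow>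
    ('a \<times> bool) list set set list \<Rightarrow> ('a \<times> bool) list set set list set set" where
  "eta \<V> A \<D> = point_class (ext_variety \<V> (stone (D1 A \<D>)))"

definition semidirect :: "(nat set \<Rightarrow> nat list set set) \<Rightarrow> 'a set \<Rightarrow> ('a \<times> bool) list set set \<Rightarrow>
    (('a \<times> bool) list set set list set set \<times> 'a list set set) monoid" where
  "semidirect \<V> A \<D> =
     \<lparr>carrier = eta \<V> A \<D> ` lists (T_set A \<D>) \<times> M_set A \<D>,
      mult = (\<lambda>(e, m) (e', m').
        (THE e''. \<exists>x \<in> lists (T_set A \<D>). \<exists>x' \<in> lists (T_set A \<D>).
           e = eta \<V> A \<D> x \<and> e' = eta \<V> A \<D> x' \<and>
           e'' = eta \<V> A \<D> (map (rho A \<D> m') x @ map (lam A \<D> m) x'),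
         mult_M A \<D> m m')),
      one = (eta \<V> A \<D> [], point_class (D0 A \<D>) [])\<rparr>"

definition free_monoid :: "'a set \<Rightarrow> 'a list monoid" where
  "free_monoid A = \<lparr>carrier = lists A, mult = (@), one = []\<rparr>"


section \<open>The languages on the right-hand side\<close>

definition tau :: "('a \<times> bool) list set set \<Rightarrow> 'a list \<Rightarrow> ('a \<times> bool) list set set list" where
  "tau \<E> w = map (\<lambda>i. point_class \<E> (mark w i)) [1..<length w + 1]"

definition odot :: "(nat set \<Rightarrow> nat list set set) \<Rightarrow> 'a set \<Rightarrow> ('a \<times> bool) list set set \<Rightarrow>
    'a list set set" where
  "odot \<V> A \<E> = {{w \<in> lists A. tau \<E> w \<in> K} | K. K \<in> ext_variety \<V> (stone \<E>)}"

text \<open>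
  Finite unions of finite nonempty intersections: an empty intersection would be \<^const>\<open>UNIV\<close>,
  which is not a language over \<open>A\<close>.
\<close>

definition lattice_combination :: "'s set set \<Rightarrow> 's set \<Rightarrow> bool" where
  "lattice_combination \<S> = finite union_of (finite' intersection_of (\<lambda>K. K \<in> \<S>))"

end

theory Submission
  imports Defs
begin

text \<open>
  By induction on \<open>w\<close>, the homomorphism sends \<open>w\<close> to \<open>(\<eta>(\<tau>(w)), [w])\<close>: appending a letter \<open>a\<close> extends
  each marked prefix \<open>(w, i)\<close> to \<open>(wa, i)\<close>, which is \<open>\<rho>\<close>, and prepends \<open>w\<close> to \<open>(a, 1)\<close>, which is \<open>\<lambda>\<close>.
  Hence the preimage of a basic box \<open>[K] \<times> [L]\<close> is \<open>\<tau>\<^sup>-\<^sup>1(K) \<inter> L\<close>.  Both dual spaces are compact, so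
  a clopen set is a finite union of boxes.
\<close>

section \<open>Stone spaces\<close>

text \<open>The obstacle is that the multiplications and the biaction are \<open>THE\<close>
  expressions over representatives, so computing a single product first requires independence of the
  choices. Three closure properties supply it. For \<open>mult_M\<close> it is closure of D0 under
  quotients. For the action of M on T it is that a language of D1, divided by a marked word, has its
  plain part in D0. For \<open>eta\<close> classes it is closure of \<open>ext_variety\<close> under
  quotients and under inverse images of continuous letter maps; this is why the actions must be
  continuous on the whole dual of D1 and not only defined on T. In the converse direction of the
  theorem, a generator of either kind is the preimage of a box whose other factor is the whole dual
  space, and preimages commute with finite unions and with nonempty finite intersections.\<close>

lemma ultrafilter_extension:
  assumes "algebra \<Omega> \<B>" and "F \<subseteq> \<B>"
    and fip: "\<And>G. finite G \<Longrightarrow> G \<subseteq> F \<Longrightarrow> \<Omega> \<inter> \<Inter>G \<noteq> {}"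
  obtains x where "x \<in> ultrafilters \<B>" "F \<subseteq> x"
proof -
  interpret algebra \<Omega> \<B> by fact
  have top_eq: "\<Union>\<B> = \<Omega>" using space_closed top by blast
  \<comment> \<open>Finite intersections are taken inside \<Omega>. The empty subfamily then says
    that \<Omega> is nonempty, instead of giving a condition on \<open>UNIV\<close>.\<close>
  define S where "S = {H. F \<subseteq> H \<and> H \<subseteq> \<B> \<and> (\<forall>G. finite G \<longrightarrow> G \<subseteq> H \<longrightarrow> \<Omega> \<inter> \<Inter>G \<noteq> {})}"
  have "\<exists>x\<in>S. \<forall>H\<in>S. x \<subseteq> H \<longrightarrow> H = x"
  proof (rule subset_Zorn_nonempty)
    show "S \<noteq> {}" using assms(2) fip by (auto simp: S_def)
  next
    fix \<C> assume ne: "\<C> \<noteq> {}" and chain: "subset.chain S \<C>"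
    have sub: "\<C> \<subseteq> S" using chain by (auto simp: subset.chain_def)
    have "\<Omega> \<inter> \<Inter>G \<noteq> {}" if G: "finite G" "G \<subseteq> \<Union>\<C>" for G
    proof -
      obtain H where "H \<in> \<C>" "G \<subseteq> H"
        using finite_subset_Union_chain[OF G ne chain] by blast
      then show ?thesis using sub G(1) by (auto simp: S_def)
    qed
    moreover have "F \<subseteq> \<Union>\<C>"
    proof -
      obtain H where "H \<in> \<C>" using ne by blast
      moreover from this have "F \<subseteq> H" using sub by (auto simp: S_def)
      ultimately show ?thesis by blast
    qed
    moreover have "\<Union>\<C> \<subseteq> \<B>" using sub by (auto simp: S_def)
    ultimately show "\<Union>\<C> \<in> S" by (simp add: S_def)
  qed
  then obtain x where xS: "x \<in> S" and max: "\<And>H. H \<in> S \<Longrightarrow> x \<subseteq> H \<Longrightarrow> H = x" by blast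
  have xB: "x \<subseteq> \<B>" and Fx: "F \<subseteq> x"
    and xfip: "\<And>G. finite G \<Longrightarrow> G \<subseteq> x \<Longrightarrow> \<Omega> \<inter> \<Inter>G \<noteq> {}"
    using xS by (auto simp: S_def)
  \<comment> \<open>Maximality in usable form: a member of \<B> that meets every finite intersection
    from x can be adjoined to x, hence belongs to it already. Most ultrafilter axioms below are read
    off from this.\<close>
  have mem: "K \<in> x" if K: "K \<in> \<B>"
    and meets: "\<And>G. finite G \<Longrightarrow> G \<subseteq> x \<Longrightarrow> \<Omega> \<inter> \<Inter>G \<inter> K \<noteq> {}" for K
  proof -
    have "\<Omega> \<inter> \<Inter>G \<noteq> {}" if "finite G" "G \<subseteq> insert K x" for G
    proof -
      have "\<Omega> \<inter> \<Inter>(G - {K}) \<inter> K \<noteq> {}"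
        using that by (intro meets) auto
      then show ?thesis by blast
    qed
    then have "insert K x \<in> S" using xB Fx K by (auto simp: S_def)
    then show ?thesis using max by blast
  qed
  have "x \<in> ultrafilters \<B>"
    unfolding ultrafilters_def mem_Collect_eq top_eq
  proof (intro conjI ballI impI)
    show "x \<subseteq> \<B>" by fact
    show "\<Omega> \<in> x" using xfip by (intro mem) (auto simp: Int_absorb2 Int_commute)
    show "{} \<notin> x" using xfip[of "{{}}"] by auto
  next
    fix K L assume KL: "K \<in> x" "L \<in> x"
    show "K \<inter> L \<in> x"
    proof (rule mem)
      show "\<Omega> \<inter> \<Inter>G \<inter> (K \<inter> L) \<noteq> {}" if "finite G" "G \<subseteq> x" for G
        using xfip[of "insert K (insert L G)"] that KL by (auto simp: Int_ac)
    qed (use KL xB in blast)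
  next
    fix K L assume KL: "K \<in> x" "L \<in> \<B>" "K \<subseteq> L"
    show "L \<in> x"
    proof (rule mem)
      show "\<Omega> \<inter> \<Inter>G \<inter> L \<noteq> {}" if "finite G" "G \<subseteq> x" for G
        using xfip[of "insert K G"] that KL by auto
    qed fact
  next
    fix L assume L: "L \<in> \<B>"
    show "L \<in> x \<or> \<Omega> - L \<in> x"
    proof (rule ccontr)
      assume "\<not> ?thesis"
      \<comment> \<open>Finite families G and G' witness that L and its complement are both
        excluded. A point common to G and G' would lie neither in L nor outside it.\<close>
      then obtain G G' where G: "finite G" "G \<subseteq> x" "\<Omega> \<inter> \<Inter>G \<inter> L = {}"
        and G': "finite G'" "G' \<subseteq> x" "\<Omega> \<inter> \<Inter>G' \<inter> (\<Omega> - L) = {}"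
        using mem[of L] mem[of "\<Omega> - L"] L compl_sets by metis
      have "\<Omega> \<inter> \<Inter>(G \<union> G') \<noteq> {}" using G G' by (intro xfip) auto
      then obtain y where "y \<in> \<Omega>" "y \<in> \<Inter>G" "y \<in> \<Inter>G'" by blast
      then show False using G(3) G'(3) by blast
    qed
  qed
  then show thesis using Fx that by blast
qed

lemma Compl_in_ultrafilter_iff:
  assumes "algebra \<Omega> \<B>" "x \<in> ultrafilters \<B>" "L \<in> \<B>"
  shows "\<Omega> - L \<in> x \<longleftrightarrow> L \<notin> x"
proof -
  interpret algebra \<Omega> \<B> by fact
  have "\<Union>\<B> = \<Omega>" using space_closed top by blast
  then have x: "{} \<notin> x" "\<And>K L. K \<in> x \<Longrightarrow> L \<in> x \<Longrightarrow> K \<inter> L \<in> x"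
      "\<And>L. L \<in> \<B> \<Longrightarrow> L \<in> x \<or> \<Omega> - L \<in> x"
    using assms(2) by (simp_all add: ultrafilters_def)
  then show ?thesis using assms(3) by (metis Diff_disjoint)
qed

lemma Int_in_ultrafilter_iff:
  assumes "algebra \<Omega> \<B>" "x \<in> ultrafilters \<B>" "K \<in> \<B>" "L \<in> \<B>"
  shows "K \<inter> L \<in> x \<longleftrightarrow> K \<in> x \<and> L \<in> x"
proof
  show "K \<in> x \<and> L \<in> x" if "K \<inter> L \<in> x"
    using assms(2-4) that Int_lower1[of K L] Int_lower2[of K L] unfolding ultrafilters_def by blast
  show "K \<inter> L \<in> x" if "K \<in> x \<and> L \<in> x"
    using assms(2) that by (simp add: ultrafilters_def)
qed

section \<open>Basic clopen sets, compactness and dual maps\<close>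

definition stone_basic :: "'s set set \<Rightarrow> 's set \<Rightarrow> 's set set set" where
  "stone_basic \<B> L = {x \<in> ultrafilters \<B>. L \<in> x}"

lemma openin_stone_basic: "L \<in> \<B> \<Longrightarrow> openin (stone \<B>) (stone_basic \<B> L)"
  unfolding stone_def stone_basic_def by (rule topology_generated_by_Basis) blast

lemma closedin_stone_basic:
  assumes "algebra \<Omega> \<B>" "L \<in> \<B>"
  shows "closedin (stone \<B>) (stone_basic \<B> L)"
proof -
  have "topspace (stone \<B>) - stone_basic \<B> L = stone_basic \<B> (\<Omega> - L)"
    using Compl_in_ultrafilter_iff[OF assms(1) _ assms(2)]
    by (auto simp: topspace_stone[OF assms(1)] stone_basic_def)
  moreover have "openin (stone \<B>) (stone_basic \<B> (\<Omega> - L))"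
    using assms by (intro openin_stone_basic) (auto dest: algebra.compl_sets)
  ultimately show ?thesis
    by (auto simp: closedin_def topspace_stone[OF assms(1)] stone_basic_def)
qed

text \<open>\<open>stone\<close> only declares these sets to be a subbase. They already form a base,
  since an ultrafilter contains \<open>K \<inter> L\<close> exactly when it contains both K and
  L.\<close>

lemma stone_basic_neighbourhood:
  assumes "algebra \<Omega> \<B>" "openin (stone \<B>) U" "x \<in> U"
  obtains L where "L \<in> \<B>" "x \<in> stone_basic \<B> L" "stone_basic \<B> L \<subseteq> U"
proof -
  interpret algebra \<Omega> \<B> by fact
  have "generate_topology_on {{x \<in> ultrafilters \<B>. L \<in> x} | L. L \<in> \<B>} U"
    using assms(2) by (simp add: stone_def openin_topology_generated_by_iff)
  then have "\<forall>x\<in>U. \<exists>L\<in>\<B>. x \<in> stone_basic \<B> L \<and> stone_basic \<B> L \<subseteq> U"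
  proof induction
    case (Int U V)
    show ?case
    proof
      fix x assume "x \<in> U \<inter> V"
      then have x: "x \<in> U" "x \<in> V" by auto
      obtain K where K: "K \<in> \<B>" "x \<in> stone_basic \<B> K" "stone_basic \<B> K \<subseteq> U"
        using Int.IH(1) x(1) by blast
      obtain L where L: "L \<in> \<B>" "x \<in> stone_basic \<B> L" "stone_basic \<B> L \<subseteq> V"
        using Int.IH(2) x(2) by blast
      have "stone_basic \<B> (K \<inter> L) = stone_basic \<B> K \<inter> stone_basic \<B> L"
        using K(1) L(1) Int_in_ultrafilter_iff[OF assms(1)] by (auto simp: stone_basic_def)
      then show "\<exists>L\<in>\<B>. x \<in> stone_basic \<B> L \<and> stone_basic \<B> L \<subseteq> U \<inter> V"
        using K L by (intro bexI[of _ "K \<inter> L"]) auto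
    qed
  next
    case (UN \<U>)
    show ?case
    proof
      fix x assume "x \<in> \<Union>\<U>"
      then obtain U where "U \<in> \<U>" "x \<in> U" by blast
      then obtain L where "L \<in> \<B>" "x \<in> stone_basic \<B> L" "stone_basic \<B> L \<subseteq> U"
        using UN.IH by blast
      then show "\<exists>L\<in>\<B>. x \<in> stone_basic \<B> L \<and> stone_basic \<B> L \<subseteq> \<Union>\<U>" using \<open>U \<in> \<U>\<close> by blast
    qed
  next
    case (Basis U)
    then obtain L where "L \<in> \<B>" "U = stone_basic \<B> L" by (auto simp: stone_basic_def)
    then show ?case by blast
  qed simp
  then show thesis using assms(3) that by blast
qed

text \<open>Refine the cover to basic sets. If no finitely many of their indices covered \<Omega>,
  the complements would have the finite intersection property, and an ultrafilter containing all of
  them would lie outside every member of the cover.\<close>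

lemma compact_space_stone:
  assumes "algebra \<Omega> \<B>"
  shows "compact_space (stone \<B>)"
  unfolding compact_space_alt
proof (intro allI impI)
  interpret algebra \<Omega> \<B> by fact
  fix \<U> assume U: "(\<forall>U\<in>\<U>. openin (stone \<B>) U) \<and> topspace (stone \<B>) \<subseteq> \<Union>\<U>"
  define N where "N = {L \<in> \<B>. \<exists>U\<in>\<U>. stone_basic \<B> L \<subseteq> U}"
  define F where "F = (\<lambda>L. \<Omega> - L) ` N"
  have FB: "F \<subseteq> \<B>" using compl_sets by (auto simp: F_def N_def)
  have "\<exists>G. finite G \<and> G \<subseteq> F \<and> \<Omega> \<inter> \<Inter>G = {}"
  proof (rule ccontr)
    assume "\<not> ?thesis"
    then obtain x where x: "x \<in> ultrafilters \<B>" "F \<subseteq> x"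
      using ultrafilter_extension[OF assms FB] by metis
    obtain U where "U \<in> \<U>" "x \<in> U" using U x(1) by (auto simp: topspace_stone[OF assms])
    then obtain L where L: "L \<in> \<B>" "x \<in> stone_basic \<B> L" "stone_basic \<B> L \<subseteq> U"
      using stone_basic_neighbourhood[OF assms] U by metis
    then have "\<Omega> - L \<in> x" using x(2) \<open>U \<in> \<U>\<close> by (auto simp: F_def N_def)
    then show False
      using L Compl_in_ultrafilter_iff[OF assms x(1)] by (auto simp: stone_basic_def)
  qed
  then obtain N' where N': "finite N'" "N' \<subseteq> N" "\<Omega> \<inter> (\<Inter>L\<in>N'. \<Omega> - L) = {}"
    unfolding F_def by (metis finite_subset_image)
  define pick where "pick L = (SOME U. U \<in> \<U> \<and> stone_basic \<B> L \<subseteq> U)" for L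
  have pick: "pick L \<in> \<U> \<and> stone_basic \<B> L \<subseteq> pick L" if "L \<in> N" for L
    unfolding pick_def by (rule someI_ex) (use that in \<open>auto simp: N_def\<close>)
  have "topspace (stone \<B>) \<subseteq> \<Union>(pick ` N')"
  proof
    fix x assume "x \<in> topspace (stone \<B>)"
    then have x: "x \<in> ultrafilters \<B>" by (simp add: topspace_stone[OF assms])
    \<comment> \<open>The sets in \<open>N'\<close> cover \<Omega>. An ultrafilter missing all of
      them would contain the finite intersection of their complements, which is empty.\<close>
    have "\<exists>L\<in>N'. L \<in> x"
    proof (rule ccontr)
      assume none: "\<not> ?thesis"
      have "\<Omega> \<inter> (\<Inter>L\<in>N''. \<Omega> - L) \<in> x" if "N'' \<subseteq> N'" "finite N''" for N''
        using that(2,1)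
      proof induction
        case empty
        then show ?case
          using x Compl_in_ultrafilter_iff[OF assms x, of "{}"] by (auto simp: ultrafilters_def)
      next
        case (insert L G)
        then have "\<Omega> - L \<in> x"
          using none N'(2) Compl_in_ultrafilter_iff[OF assms x, of L] by (auto simp: N_def)
        moreover have "\<Omega> \<inter> (\<Inter>L\<in>G. \<Omega> - L) \<in> x" using insert by blast
        ultimately have "(\<Omega> - L) \<inter> (\<Omega> \<inter> (\<Inter>L\<in>G. \<Omega> - L)) \<in> x"
          using x by (auto simp: ultrafilters_def)
        also have "(\<Omega> - L) \<inter> (\<Omega> \<inter> (\<Inter>L\<in>G. \<Omega> - L)) = \<Omega> \<inter> (\<Inter>L\<in>insert L G. \<Omega> - L)" by blast
        finally show ?case .
      qed
      from this[OF subset_refl N'(1)] show False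
        using x N'(3) by (simp add: ultrafilters_def)
    qed
    then show "x \<in> \<Union>(pick ` N')"
      using x pick N'(2) by (fastforce simp: stone_basic_def)
  qed
  then show "\<exists>\<F>. finite \<F> \<and> \<F> \<subseteq> \<U> \<and> topspace (stone \<B>) \<subseteq> \<Union>\<F>"
    using N' pick by (intro exI[of _ "pick ` N'"]) auto
qed

lemma clopen_prod_stone:
  assumes "algebra \<Omega> \<B>" "algebra \<Omega>' \<B>'"
    and "openin (prod_topology (stone \<B>) (stone \<B>')) C"
    and "closedin (prod_topology (stone \<B>) (stone \<B>')) C"
  obtains P where "finite P" "P \<subseteq> \<B> \<times> \<B>'"
    "C = (\<Union>(K, L)\<in>P. stone_basic \<B> K \<times> stone_basic \<B>' L)"
proof -
  define box where "box = (\<lambda>(K, L). stone_basic \<B> K \<times> stone_basic \<B>' L)"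
  define \<P> where "\<P> = {p \<in> \<B> \<times> \<B>'. box p \<subseteq> C}"
  have "compactin (prod_topology (stone \<B>) (stone \<B>')) C"
    using assms(4) compact_space_stone[OF assms(1)] compact_space_stone[OF assms(2)]
    by (simp add: closedin_compact_space compact_space_prod_topology)
  moreover have "openin (prod_topology (stone \<B>) (stone \<B>')) U" if "U \<in> box ` \<P>" for U
    using that by (auto simp: box_def \<P>_def openin_prod_Times_iff intro: openin_stone_basic)
  moreover have "C \<subseteq> \<Union>(box ` \<P>)"
  proof
    fix z assume z: "z \<in> C"
    obtain x y where xy: "z = (x, y)" by (cases z)
    obtain U V where UV: "openin (stone \<B>) U" "openin (stone \<B>') V" "x \<in> U" "y \<in> V" "U \<times> V \<subseteq> C"
      using openin_prod_topology_alt[THEN iffD1, OF assms(3), rule_format, of x y] z xy by blast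
    obtain K where K: "K \<in> \<B>" "x \<in> stone_basic \<B> K" "stone_basic \<B> K \<subseteq> U"
      using stone_basic_neighbourhood[OF assms(1) UV(1,3)] .
    obtain L where L: "L \<in> \<B>'" "y \<in> stone_basic \<B>' L" "stone_basic \<B>' L \<subseteq> V"
      using stone_basic_neighbourhood[OF assms(2) UV(2,4)] .
    have "(K, L) \<in> \<P>" "z \<in> box (K, L)" using K L UV(5) xy by (auto simp: \<P>_def box_def)
    then show "z \<in> \<Union>(box ` \<P>)" by blast
  qed
  ultimately obtain \<F> where "finite \<F>" "\<F> \<subseteq> box ` \<P>" "C \<subseteq> \<Union>\<F>"
    unfolding compactin_def by meson
  then obtain P where P: "finite P" "P \<subseteq> \<P>" "C \<subseteq> \<Union>(box ` P)"
    by (metis finite_subset_image)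
  then have "C = \<Union>(box ` P)" by (auto simp: \<P>_def)
  then show thesis using P(1,2) that by (auto simp: \<P>_def box_def)
qed

text \<open>This is the Stone dual of the Boolean homomorphism that takes L to its preimage under f.
  Ultrafilters go to ultrafilters because taking preimages commutes with the Boolean operations, and
  a basic set pulls back to a basic set. It yields continuity of the actions of words on the dual of
  D1.\<close>

lemma continuous_map_stone:
  assumes "algebra \<Omega> \<B>" "algebra \<Omega>' \<B>'" "f \<in> \<Omega>' \<rightarrow> \<Omega>"
    and pre: "\<And>L. L \<in> \<B> \<Longrightarrow> {s \<in> \<Omega>'. f s \<in> L} \<in> \<B>'"
  shows "continuous_map (stone \<B>') (stone \<B>) (\<lambda>x. {L \<in> \<B>. {s \<in> \<Omega>'. f s \<in> L} \<in> x})"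
proof -
  interpret B: algebra \<Omega> \<B> by fact
  interpret B': algebra \<Omega>' \<B>' by fact
  have tops: "\<Union>\<B> = \<Omega>" "\<Union>\<B>' = \<Omega>'" using B.space_closed B.top B'.space_closed B'.top by blast+
  define F where "F = (\<lambda>x. {L \<in> \<B>. {s \<in> \<Omega>'. f s \<in> L} \<in> x})"
  have F_iff: "L \<in> F x \<longleftrightarrow> L \<in> \<B> \<and> {s \<in> \<Omega>'. f s \<in> L} \<in> x" for L x
    by (simp add: F_def)
  have F: "F x \<in> ultrafilters \<B>" if x: "x \<in> ultrafilters \<B>'" for x
    unfolding ultrafilters_def mem_Collect_eq tops
  proof (intro conjI ballI impI)
    have "{s \<in> \<Omega>'. f s \<in> \<Omega>} = \<Omega>'" using assms(3) by blast
    then show "\<Omega> \<in> F x" using x B.top tops by (simp add: F_iff ultrafilters_def)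
    show "{} \<notin> F x" using x by (simp add: F_iff ultrafilters_def)
  next
    fix K L assume KL: "K \<in> F x" "L \<in> F x"
    have "{s \<in> \<Omega>'. f s \<in> K \<inter> L} = {s \<in> \<Omega>'. f s \<in> K} \<inter> {s \<in> \<Omega>'. f s \<in> L}" by blast
    then show "K \<inter> L \<in> F x" using KL x B.Int by (simp add: F_iff ultrafilters_def)
  next
    fix K L assume KL: "K \<in> F x" "L \<in> \<B>" "K \<subseteq> L"
    have "{s \<in> \<Omega>'. f s \<in> K} \<subseteq> {s \<in> \<Omega>'. f s \<in> L}" using KL by blast
    then show "L \<in> F x" using KL x pre[OF KL(2)] unfolding F_iff ultrafilters_def by blast
  next
    fix L assume L: "L \<in> \<B>"
    have "{s \<in> \<Omega>'. f s \<in> \<Omega> - L} = \<Omega>' - {s \<in> \<Omega>'. f s \<in> L}" using assms(3) by blast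
    then show "L \<in> F x \<or> \<Omega> - L \<in> F x"
      using Compl_in_ultrafilter_iff[OF assms(2) x pre[OF L]] L by (auto simp: F_iff)
  qed (auto simp: F_iff)
  show ?thesis unfolding F_def[symmetric]
  \<comment> \<open>Only the codomain is unfolded, so that continuity has to be checked on its
    subbase alone.\<close>
  proof (subst (2) stone_def, rule continuous_on_generated_topo)
    show "F ` topspace (stone \<B>') \<subseteq> \<Union>{{x \<in> ultrafilters \<B>. L \<in> x} | L. L \<in> \<B>}"
    proof
      fix y assume "y \<in> F ` topspace (stone \<B>')"
      then have "y \<in> ultrafilters \<B>" using F by (auto simp: topspace_stone[OF assms(2)])
      moreover from this have "\<Omega> \<in> y" by (simp add: ultrafilters_def tops)
      ultimately show "y \<in> \<Union>{{x \<in> ultrafilters \<B>. L \<in> x} | L. L \<in> \<B>}" using B.top by blast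
    qed
  next
    fix U assume "U \<in> {{x \<in> ultrafilters \<B>. L \<in> x} | L. L \<in> \<B>}"
    then obtain L where L: "L \<in> \<B>" "U = {x \<in> ultrafilters \<B>. L \<in> x}" by blast
    then have "F -` U \<inter> topspace (stone \<B>') = stone_basic \<B>' {s \<in> \<Omega>'. f s \<in> L}"
      using F by (auto simp: F_iff topspace_stone[OF assms(2)] stone_basic_def)
    then show "openin (stone \<B>') (F -` U \<inter> topspace (stone \<B>'))"
      using openin_stone_basic[OF pre[OF L(1)]] by simp
  qed
qed


section \<open>Extension of an lp-variety to a Boolean space\<close>

lemma lp_variety_algebra:
  assumes "lp_variety \<V>" "finite B"
  shows "algebra (lists B) (\<V> B)"
  using assms by (simp add: lp_variety_def quotient_algebra_def)

lemma lp_variety_preimage: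
  assumes "lp_variety \<V>" "finite B" "finite B'" "f ` B' \<subseteq> B" "K \<in> \<V> B"
  shows "{w \<in> lists B'. map f w \<in> K} \<in> \<V> B'"
  using assms by (simp add: lp_variety_def)

lemma lp_variety_quot:
  assumes "lp_variety \<V>" "finite B" "K \<in> \<V> B" "u \<in> lists B" "v \<in> lists B"
  shows "{w \<in> lists B. u @ w @ v \<in> K} \<in> \<V> B"
proof -
  interpret algebra "lists B" "\<V> B" using lp_variety_algebra assms by blast
  have "rquot (lquot u K) v \<in> \<V> B"
    using assms by (simp add: lp_variety_def quotient_algebra_def closed_under_quotients_def)
  \<comment> \<open>\<open>lquot\<close> and \<open>rquot\<close> do not restrict the alphabet.
    Words of K are over B, so all their factors are too.\<close>
  moreover have "w \<in> lists B" if "u @ w @ v \<in> K" for w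
    using that space_closed assms(3) by (meson PowD append_in_lists_conv subsetD)
  then have "rquot (lquot u K) v = {w \<in> lists B. u @ w @ v \<in> K}"
    by (auto simp: rquot_def lquot_def)
  ultimately show ?thesis by simp
qed

text \<open>The map need not be onto: restrict the language to words over its image.\<close>

lemma ext_varietyI:
  assumes "lp_variety \<V>" "finite B" "continuous_map Y (discrete_topology B) g" "K \<in> \<V> B"
  shows "{x \<in> lists (topspace Y). map g x \<in> K} \<in> ext_variety \<V> Y"
proof -
  define B' where "B' = g ` topspace Y"
  have B': "B' \<subseteq> B" using assms(3) by (auto simp: B'_def continuous_map_def)
  have fin: "finite B'" using B' assms(2) finite_subset by blast
  have "continuous_map Y (subtopology (discrete_topology B) B') g"
    using assms(3) by (rule continuous_map_into_subtopology) (auto simp: B'_def)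
  then have "continuous_map Y (discrete_topology B') g"
    using B' by (simp add: subtopology_discrete_topology Int_absorb1)
  moreover have "{w \<in> lists B'. map id w \<in> K} \<in> \<V> B'"
    using assms(1,2) fin _ assms(4) by (rule lp_variety_preimage) (use B' in auto)
  moreover have "{x \<in> lists (topspace Y). map g x \<in> K}
      = {x \<in> lists (topspace Y). map g x \<in> {w \<in> lists B'. map id w \<in> K}}"
    by (auto simp: B'_def in_lists_conv_set)
  ultimately show ?thesis
    using fin unfolding ext_variety_def B'_def by blast
qed

lemma ext_varietyE:
  assumes "J \<in> ext_variety \<V> Y"
  obtains g B K where "finite B" "continuous_map Y (discrete_topology B) g" "K \<in> \<V> B"
    "J = {x \<in> lists (topspace Y). map g x \<in> K}"
  using assms by (auto simp: ext_variety_def)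

lemma map_in_lists_topspace:
  "continuous_map Y Z g \<Longrightarrow> x \<in> lists (topspace Y) \<Longrightarrow> map g x \<in> lists (topspace Z)"
  by (auto simp: continuous_map_def in_lists_conv_set)

lemma algebra_ext_variety:
  assumes V: "lp_variety \<V>"
  shows "algebra (lists (topspace Y)) (ext_variety \<V> Y)"
proof -
  let ?E = "ext_variety \<V> Y" and ?X = "lists (topspace Y)"
  have "{} \<in> ?E"
  proof -
    have "{} \<in> \<V> {0}" using lp_variety_algebra[OF V, of "{0}"] by (simp add: algebra_iff_Un)
    from ext_varietyI[OF V _ _ this, of Y "\<lambda>_. 0"] show ?thesis by simp
  qed
  moreover have "?X - J \<in> ?E" if J: "J \<in> ?E" for J
  proof -
    obtain g B K where g: "finite B" "continuous_map Y (discrete_topology B) g" "K \<in> \<V> B"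
      "J = {x \<in> ?X. map g x \<in> K}" using ext_varietyE[OF J] .
    have "lists B - K \<in> \<V> B" using lp_variety_algebra[OF V g(1)] g(3) by (simp add: algebra_iff_Un)
    from ext_varietyI[OF V g(1,2) this] show ?thesis
      using map_in_lists_topspace[OF g(2)] unfolding g(4)
      by (elim back_subst[of "\<lambda>S. S \<in> ?E"]) auto
  qed
  moreover have "J1 \<union> J2 \<in> ?E" if J: "J1 \<in> ?E" "J2 \<in> ?E" for J1 J2
  proof -
    obtain g1 B1 K1 where g1: "finite B1" "continuous_map Y (discrete_topology B1) g1" "K1 \<in> \<V> B1"
      "J1 = {x \<in> ?X. map g1 x \<in> K1}" using ext_varietyE[OF J(1)] .
    obtain g2 B2 K2 where g2: "finite B2" "continuous_map Y (discrete_topology B2) g2" "K2 \<in> \<V> B2"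
      "J2 = {x \<in> ?X. map g2 x \<in> K2}" using ext_varietyE[OF J(2)] .
    \<comment> \<open>Both languages are read through the common refinement of \<open>g1\<close> and
      \<open>g2\<close>. Alphabets are sets of naturals, so pairs of letters are coded by
      \<open>prod_encode\<close>; \<open>f1\<close> and \<open>f2\<close> are the letter maps that
      recover the components.\<close>
    define B where "B = prod_encode ` (B1 \<times> B2)"
    define g where "g y = prod_encode (g1 y, g2 y)" for y
    define f1 where "f1 = fst \<circ> prod_decode"
    define f2 where "f2 = snd \<circ> prod_decode"
    have fin: "finite B" using g1(1) g2(1) by (simp add: B_def)
    have "continuous_map Y (prod_topology (discrete_topology B1) (discrete_topology B2)) (\<lambda>y. (g1 y, g2 y))"
      using g1(2) g2(2) by (simp add: continuous_map_pairedI)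
    moreover have "continuous_map (prod_topology (discrete_topology B1) (discrete_topology B2))
        (discrete_topology B) prod_encode"
      by (simp add: B_def flip: prod_topology_discrete_topology)
    ultimately have "continuous_map Y (discrete_topology B) (prod_encode \<circ> (\<lambda>y. (g1 y, g2 y)))"
      by (rule continuous_map_compose)
    then have g: "continuous_map Y (discrete_topology B) g" by (simp add: g_def[abs_def] comp_def)
    have f: "f1 ` B \<subseteq> B1" "f2 ` B \<subseteq> B2" by (auto simp: f1_def f2_def B_def)
    have "{w \<in> lists B. map f1 w \<in> K1} \<union> {w \<in> lists B. map f2 w \<in> K2} \<in> \<V> B"
      using lp_variety_preimage[OF V g1(1) fin f(1) g1(3)] lp_variety_preimage[OF V g2(1) fin f(2) g2(3)]
        lp_variety_algebra[OF V fin] by (simp add: algebra_iff_Un)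
    from ext_varietyI[OF V fin g this] show ?thesis
      using map_in_lists_topspace[OF g] unfolding g1(4) g2(4)
      by (elim back_subst[of "\<lambda>S. S \<in> ?E"]) (auto simp: comp_def f1_def f2_def g_def)
  qed
  moreover have "?E \<subseteq> Pow ?X" by (auto simp: ext_variety_def)
  ultimately show ?thesis by (auto simp: algebra_iff_Un)
qed

text \<open>A finite colouring of Z composed with f is a finite colouring of Y. It may miss letters
  of B, which \<open>ext_varietyI\<close> permits.\<close>

lemma ext_variety_preimage:
  assumes "lp_variety \<V>" "continuous_map Y Z f" "J \<in> ext_variety \<V> Z"
  shows "{x \<in> lists (topspace Y). map f x \<in> J} \<in> ext_variety \<V> Y"
proof -
  obtain g B K where g: "finite B" "continuous_map Z (discrete_topology B) g" "K \<in> \<V> B"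
    "J = {x \<in> lists (topspace Z). map g x \<in> K}" using ext_varietyE[OF assms(3)] .
  from ext_varietyI[OF assms(1) g(1) continuous_map_compose[OF assms(2) g(2)] g(3)]
  show ?thesis using map_in_lists_topspace[OF assms(2)] unfolding g(4)
    by (elim back_subst[of "\<lambda>S. S \<in> _"]) auto
qed

text \<open>The colouring acts letterwise, so dividing by words over Y becomes dividing K by their
  images over B.\<close>

lemma ext_variety_quot:
  assumes "lp_variety \<V>" "J \<in> ext_variety \<V> Y" "u \<in> lists (topspace Y)" "v \<in> lists (topspace Y)"
  shows "{x \<in> lists (topspace Y). u @ x @ v \<in> J} \<in> ext_variety \<V> Y"
proof -
  obtain g B K where g: "finite B" "continuous_map Y (discrete_topology B) g" "K \<in> \<V> B"
    "J = {x \<in> lists (topspace Y). map g x \<in> K}" using ext_varietyE[OF assms(2)] .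
  have uv: "map g u \<in> lists B" "map g v \<in> lists B"
    using map_in_lists_topspace[OF g(2)] assms(3,4) by auto
  from ext_varietyI[OF assms(1) g(1,2) lp_variety_quot[OF assms(1) g(1,3) uv]]
  show ?thesis using map_in_lists_topspace[OF g(2)] assms(3,4) unfolding g(4)
    by (elim back_subst[of "\<lambda>S. S \<in> _"]) auto
qed

section \<open>Compatibility of point classes with concatenation and letter maps\<close>

lemma point_class_eqI:
  "(\<And>L. L \<in> \<B> \<Longrightarrow> s \<in> L \<longleftrightarrow> t \<in> L) \<Longrightarrow> point_class \<B> s = point_class \<B> t"
  by (auto simp: point_class_def)

lemma point_class_eqD:
  "point_class \<B> s = point_class \<B> t \<Longrightarrow> L \<in> \<B> \<Longrightarrow> s \<in> L \<longleftrightarrow> t \<in> L"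
  by (auto simp: point_class_def)

text \<open>This makes the product of \<open>eta\<close> classes well defined; f and g will be a
  right and a left action. The words are exchanged one at a time. With the other block fixed, the
  condition on z that the concatenation lies in J is a quotient of J pulled back along a continuous
  letter map, hence a language of \<open>ext_variety\<close>, which cannot separate words of the
  same class.\<close>

lemma point_class_ext_variety_cong:
  fixes Y :: "'y topology"
  assumes V: "lp_variety \<V>" and f: "continuous_map Y Y f" and g: "continuous_map Y Y g"
    and in_lists: "x \<in> lists (topspace Y)" "x' \<in> lists (topspace Y)"
      "y \<in> lists (topspace Y)" "y' \<in> lists (topspace Y)"
    and x: "point_class (ext_variety \<V> Y) x = point_class (ext_variety \<V> Y) x'"
    and y: "point_class (ext_variety \<V> Y) y = point_class (ext_variety \<V> Y) y'"
  shows "point_class (ext_variety \<V> Y) (map f x @ map g y)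
       = point_class (ext_variety \<V> Y) (map f x' @ map g y')"
proof (rule point_class_eqI)
  fix J assume J: "J \<in> ext_variety \<V> Y"
  have 1: "map f z \<in> lists (topspace Y)" "map g z \<in> lists (topspace Y)"
    if "z \<in> lists (topspace Y)" for z
    using map_in_lists_topspace f g that by blast+
  have "{z \<in> lists (topspace Y). [] @ z @ map g y \<in> J} \<in> ext_variety \<V> Y"
    by (rule ext_variety_quot) (use V J 1 in_lists in auto)
  from point_class_eqD[OF x ext_variety_preimage[OF V f this]]
  have "map f x @ map g y \<in> J \<longleftrightarrow> map f x' @ map g y \<in> J"
    using 1 in_lists by simp
  also have "{z \<in> lists (topspace Y). map f x' @ z @ [] \<in> J} \<in> ext_variety \<V> Y"
    by (rule ext_variety_quot) (use V J 1 in_lists in auto)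
  from point_class_eqD[OF y ext_variety_preimage[OF V g this]]
  have "map f x' @ map g y \<in> J \<longleftrightarrow> map f x' @ map g y' \<in> J"
    using 1 in_lists by simp
  finally show "map f x @ map g y \<in> J \<longleftrightarrow> map f x' @ map g y' \<in> J" .
qed


section \<open>Marked words and the biaction\<close>

lemma plain_append [simp]: "plain (u @ v) = plain u @ plain v"
  by (simp add: plain_def)

lemma plain_Nil [simp]: "plain [] = []"
  by (simp add: plain_def)

lemma filter_snd_plain [simp]: "filter snd (plain u) = []"
  by (simp add: plain_def)

lemma plain_in_lists: "u \<in> lists A \<Longrightarrow> plain u \<in> lists (A \<times> UNIV)"
  by (auto simp: plain_def in_lists_conv_set)

lemma plain_map_fst: "filter snd v = [] \<Longrightarrow> plain (map fst v) = v"
  by (induction v) (auto simp: plain_def split: if_splits)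

text \<open>Counting marks eliminates the position i: whether a concatenation is a marked word is
  then decided by adding counts.\<close>

lemma marked_iff: "v \<in> marked A \<longleftrightarrow> v \<in> lists (A \<times> UNIV) \<and> length (filter snd v) = 1"
proof
  assume "v \<in> marked A"
  then obtain w i where w: "v = mark w i" "w \<in> lists A" "1 \<le> i" "i \<le> length w"
    by (auto simp: marked_def)
  then have "w ! (i - 1) \<in> A" by (auto simp: in_lists_conv_set)
  moreover have "plain (take (i - 1) w) \<in> lists (A \<times> UNIV)" "plain (drop i w) \<in> lists (A \<times> UNIV)"
    using w(2) by (auto intro!: plain_in_lists dest: in_set_takeD in_set_dropD)
  ultimately show "v \<in> lists (A \<times> UNIV) \<and> length (filter snd v) = 1"
    by (auto simp: w(1) mark_def)
next
  assume v: "v \<in> lists (A \<times> UNIV) \<and> length (filter snd v) = 1"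
  then obtain p where "filter snd v = [p]" by (auto simp: length_Suc_conv)
  then obtain us vs where "v = us @ p # vs" "\<forall>q\<in>set us. \<not> snd q" "snd p" "[] = filter snd vs"
    using filter_eq_ConsD[of snd v p "[]"] by blast
  then have uv: "v = us @ p # vs" "filter snd us = []" "snd p" "filter snd vs = []" by auto
  let ?w = "map fst v"
  have "p = (fst p, True)" using uv(3) by (cases p) auto
  \<comment> \<open>Positions count from 1, so the marked letter following the prefix
    \<open>us\<close> stands at \<open>length us + 1\<close>.\<close>
  then have "mark ?w (length us + 1) = v"
    using uv by (simp add: mark_def nth_append plain_map_fst)
  moreover have "?w \<in> lists A" using v by (auto simp: in_lists_conv_set)
  ultimately show "v \<in> marked A"
    unfolding marked_def
    by (intro CollectI exI[of _ ?w] exI[of _ "length us + 1"]) (simp add: uv(1))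
qed

lemma mark_append_plain:
  "1 \<le> i \<Longrightarrow> i \<le> length w \<Longrightarrow> mark w i @ plain v = mark (w @ v) i"
  by (auto simp: mark_def nth_append)

lemma plain_append_mark:
  "1 \<le> i \<Longrightarrow> i \<le> length w \<Longrightarrow> plain u @ mark w i = mark (u @ w) (length u + i)"
  by (auto simp: mark_def nth_append)

lemma append_marked:
  assumes "u \<in> lists A"
  shows "plain u @ s \<in> marked A \<longleftrightarrow> s \<in> marked A" "s @ plain u \<in> marked A \<longleftrightarrow> s \<in> marked A"
  using plain_in_lists[OF assms] by (auto simp: marked_iff)

section \<open>The algebras D0 and D1 and the monoid M\<close>

locale marked_algebra =
  fixes A :: "'a set" and \<V> :: "nat set \<Rightarrow> nat list set set" and \<D> :: "('a \<times> bool) list set set"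
  assumes lp_variety: "lp_variety \<V>"
    and quotient_algebra: "quotient_algebra (A \<times> UNIV) \<D>"
    and marked_in: "marked A \<in> \<D>"
begin

abbreviation "word_class \<equiv> point_class (D0 A \<D>)"
abbreviation "marked_class \<equiv> point_class (D1 A \<D>)"
abbreviation "X \<equiv> stone (D1 A \<D>)"

sublocale D: algebra "lists (A \<times> UNIV)" \<D>
  using quotient_algebra by (simp add: quotient_algebra_def)

lemma quot_in_D:
  assumes "L \<in> \<D>" "u \<in> lists (A \<times> UNIV)"
  shows "lquot u L \<in> \<D>" "rquot L u \<in> \<D>"
proof -
  have quot: "rquot (lquot u L) v \<in> \<D>"
    if "u \<in> lists (A \<times> UNIV)" "v \<in> lists (A \<times> UNIV)" for u v
    using quotient_algebra assms(1) that
    by (simp add: quotient_algebra_def closed_under_quotients_def)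
  show "lquot u L \<in> \<D>" "rquot L u \<in> \<D>"
    using quot[OF assms(2), of "[]"] quot[of "[]", OF _ assms(2)]
    by (simp_all add: lquot_def rquot_def)
qed

text \<open>Because \<open>marked A\<close> is in \<D>, the trace on marked words of a member of
  \<D> is again a member of \<D>. Quotients of languages of D1 can therefore be formed in \<D>
  itself.\<close>

lemma D1_iff: "L \<in> D1 A \<D> \<longleftrightarrow> L \<in> \<D> \<and> L \<subseteq> marked A"
  using marked_in by (auto simp: D1_def)

lemma algebra_D0: "algebra (lists A) (D0 A \<D>)"
  unfolding algebra_iff_Un
proof (intro conjI ballI)
  show "D0 A \<D> \<subseteq> Pow (lists A)" by (auto simp: D0_def)
  show "{} \<in> D0 A \<D>" unfolding D0_def using D.empty_sets by blast
next
  fix K assume "K \<in> D0 A \<D>"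
  then obtain L where L: "L \<in> \<D>" "K = {u \<in> lists A. plain u \<in> L}" by (auto simp: D0_def)
  have "lists A - K = {u \<in> lists A. plain u \<in> lists (A \<times> UNIV) - L}"
    using plain_in_lists L(2) by blast
  then show "lists A - K \<in> D0 A \<D>" unfolding D0_def using D.compl_sets[OF L(1)] by blast
next
  fix K K' assume "K \<in> D0 A \<D>" "K' \<in> D0 A \<D>"
  then obtain L L' where L: "L \<in> \<D>" "K = {u \<in> lists A. plain u \<in> L}"
    "L' \<in> \<D>" "K' = {u \<in> lists A. plain u \<in> L'}" by (auto simp: D0_def)
  have "K \<union> K' = {u \<in> lists A. plain u \<in> L \<union> L'}" using L by blast
  then show "K \<union> K' \<in> D0 A \<D>" unfolding D0_def using D.Un[OF L(1,3)] by blast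
qed

lemma algebra_D1: "algebra (marked A) (D1 A \<D>)"
  using marked_in by (auto simp: algebra_iff_Un D1_iff)

lemma quot_in_D1:
  assumes "u \<in> lists A" "L \<in> D1 A \<D>"
  shows "lquot (plain u) L \<in> D1 A \<D>" "rquot L (plain u) \<in> D1 A \<D>"
proof -
  have "L \<in> \<D>" and L: "L \<subseteq> marked A" using assms(2) by (auto simp: D1_iff)
  then have "lquot (plain u) L \<in> \<D>" "rquot L (plain u) \<in> \<D>"
    using quot_in_D plain_in_lists[OF assms(1)] by auto
  moreover have "lquot (plain u) L \<subseteq> marked A" "rquot L (plain u) \<subseteq> marked A"
    using L append_marked[OF assms(1)] by (auto simp: lquot_def rquot_def)
  ultimately show "lquot (plain u) L \<in> D1 A \<D>" "rquot L (plain u) \<in> D1 A \<D>"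
    by (simp_all add: D1_iff)
qed

text \<open>A quotient by a marked word stays in \<D>, and its plain part is a language of D0. These
  are the quotients behind \<rho>_t and \<lambda>_t respectively, for t the class of s.\<close>

lemma slice_in_D0:
  assumes "L \<in> D1 A \<D>" "s \<in> marked A"
  shows "{u \<in> lists A. plain u @ s \<in> L} \<in> D0 A \<D>" "{u \<in> lists A. s @ plain u \<in> L} \<in> D0 A \<D>"
  using assms quot_in_D[of L s] by (auto simp: D1_iff marked_iff lquot_def rquot_def D0_def)

lemma quot_in_D0:
  assumes "K \<in> D0 A \<D>" "u \<in> lists A"
  shows "{v \<in> lists A. u @ v \<in> K} \<in> D0 A \<D>" "{v \<in> lists A. v @ u \<in> K} \<in> D0 A \<D>"
proof -
  obtain L where L: "L \<in> \<D>" "K = {u \<in> lists A. plain u \<in> L}" using assms by (auto simp: D0_def)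
  have "{v \<in> lists A. u @ v \<in> K} = {v \<in> lists A. plain v \<in> lquot (plain u) L}"
    "{v \<in> lists A. v @ u \<in> K} = {v \<in> lists A. plain v \<in> rquot L (plain u)}"
    using L(2) assms(2) by (auto simp: lquot_def rquot_def)
  then show "{v \<in> lists A. u @ v \<in> K} \<in> D0 A \<D>" "{v \<in> lists A. v @ u \<in> K} \<in> D0 A \<D>"
    unfolding D0_def using quot_in_D[OF L(1) plain_in_lists[OF assms(2)]] by blast+
qed

lemma mult_M_word_class:
  assumes "u \<in> lists A" "v \<in> lists A"
  shows "mult_M A \<D> (word_class u) (word_class v) = word_class (u @ v)"
proof -
  have "word_class (u @ v) = word_class (u' @ v')"
    if "u' \<in> lists A" "v' \<in> lists A" "word_class u = word_class u'" "word_class v = word_class v'"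
    for u' v'
  proof (rule point_class_eqI)
    fix K assume K: "K \<in> D0 A \<D>"
    \<comment> \<open>First u is replaced by u' with v fixed, then v by v' with u' fixed; each
      exchange uses one quotient of K.\<close>
    show "u @ v \<in> K \<longleftrightarrow> u' @ v' \<in> K"
      using point_class_eqD[OF that(3) quot_in_D0(2)[OF K assms(2)]]
        point_class_eqD[OF that(4) quot_in_D0(1)[OF K that(1)]] assms that(1,2) by simp
  qed
  then show ?thesis
    unfolding mult_M_def using assms by (intro the_equality) metis+
qed

text \<open>The action of the class of u is written with an explicit representative. Without
  \<open>THE\<close> it can be studied, and shown continuous, on the whole dual space before
  anything is known about other representatives.\<close>

definition lam_word :: "'a list \<Rightarrow> ('a \<times> bool) list set set \<Rightarrow> ('a \<times> bool) list set set" where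
  "lam_word u x = {L \<in> D1 A \<D>. lquot (plain u) L \<in> x}"

definition rho_word :: "'a list \<Rightarrow> ('a \<times> bool) list set set \<Rightarrow> ('a \<times> bool) list set set" where
  "rho_word u x = {L \<in> D1 A \<D>. rquot L (plain u) \<in> x}"

text \<open>The map is the Stone dual of prefixing \<open>plain u\<close> to marked words: plain
  letters do not change the number of marks, and the preimage of L is its left quotient.\<close>

lemma continuous_map_lam_word:
  assumes "u \<in> lists A"
  shows "continuous_map X X (lam_word u)"
proof -
  have eq: "{s \<in> marked A. plain u @ s \<in> L} = lquot (plain u) L" if "L \<in> D1 A \<D>" for L
    using that append_marked[OF assms] by (auto simp: D1_iff lquot_def)
  have "continuous_map X X (\<lambda>x. {L \<in> D1 A \<D>. {s \<in> marked A. plain u @ s \<in> L} \<in> x})"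
    by (rule continuous_map_stone[OF algebra_D1 algebra_D1])
      (auto simp: append_marked[OF assms] eq quot_in_D1[OF assms])
  then show ?thesis by (simp add: lam_word_def[abs_def] eq cong: conj_cong)
qed

lemma continuous_map_rho_word:
  assumes "u \<in> lists A"
  shows "continuous_map X X (rho_word u)"
proof -
  have eq: "{s \<in> marked A. s @ plain u \<in> L} = rquot L (plain u)" if "L \<in> D1 A \<D>" for L
    using that append_marked[OF assms] by (auto simp: D1_iff rquot_def)
  have "continuous_map X X (\<lambda>x. {L \<in> D1 A \<D>. {s \<in> marked A. s @ plain u \<in> L} \<in> x})"
    by (rule continuous_map_stone[OF algebra_D1 algebra_D1])
      (auto simp: append_marked[OF assms] eq quot_in_D1[OF assms])
  then show ?thesis by (simp add: rho_word_def[abs_def] eq cong: conj_cong)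
qed

lemma lam_word_marked_class:
  "u \<in> lists A \<Longrightarrow> lam_word u (marked_class s) = marked_class (plain u @ s)"
  using quot_in_D1 by (auto simp: lam_word_def point_class_def lquot_def)

lemma rho_word_marked_class:
  "u \<in> lists A \<Longrightarrow> rho_word u (marked_class s) = marked_class (s @ plain u)"
  using quot_in_D1 by (auto simp: rho_word_def point_class_def rquot_def)

text \<open>On \<open>T\<close> the action of \<open>[u]\<close> does not depend on the representative \<open>u\<close>, because
  \<open>{u. u s \<in> L}\<close> lies in \<open>\<D>\<^sub>0\<close> for every marked word \<open>s\<close>.\<close>

lemma lam_eq_lam_word:
  assumes "u \<in> lists A" "t \<in> T_set A \<D>"
  shows "lam A \<D> (word_class u) t = lam_word u t"
proof -
  obtain s where s: "s \<in> marked A" "t = marked_class s" using assms(2) by (auto simp: T_set_def)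
  have "lam_word u t = lam_word v t" if "v \<in> lists A" "word_class u = word_class v" for v
    unfolding s(2) lam_word_marked_class[OF assms(1)] lam_word_marked_class[OF that(1)]
  proof (rule point_class_eqI)
    fix L assume "L \<in> D1 A \<D>"
    from point_class_eqD[OF that(2) slice_in_D0(1)[OF this s(1)]]
    show "plain u @ s \<in> L \<longleftrightarrow> plain v @ s \<in> L" using assms(1) that(1) by simp
  qed
  then show ?thesis
    unfolding lam_def lam_word_def[symmetric] using assms(1) by (intro the_equality) metis+
qed

lemma rho_eq_rho_word:
  assumes "u \<in> lists A" "t \<in> T_set A \<D>"
  shows "rho A \<D> (word_class u) t = rho_word u t"
proof -
  obtain s where s: "s \<in> marked A" "t = marked_class s" using assms(2) by (auto simp: T_set_def)
  have "rho_word u t = rho_word v t" if "v \<in> lists A" "word_class u = word_class v" for v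
    unfolding s(2) rho_word_marked_class[OF assms(1)] rho_word_marked_class[OF that(1)]
  proof (rule point_class_eqI)
    fix L assume "L \<in> D1 A \<D>"
    from point_class_eqD[OF that(2) slice_in_D0(2)[OF this s(1)]]
    show "s @ plain u \<in> L \<longleftrightarrow> s @ plain v \<in> L" using assms(1) that(1) by simp
  qed
  then show ?thesis
    unfolding rho_def rho_word_def[symmetric] using assms(1) by (intro the_equality) metis+
qed

section \<open>The semidirect product and the values of the homomorphism\<close>

lemma T_subset_X: "T_set A \<D> \<subseteq> topspace X"
  using point_class_in_ultrafilters[OF algebra_D1]
  by (auto simp: T_set_def topspace_stone[OF algebra_D1])

text \<open>Here the \<open>THE\<close> expressions are evaluated. Words with the same
  \<open>eta\<close> classes give the same product because the actions of u and v are continuous on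
  the whole dual space. Passing from \<open>lam\<close> and \<open>rho\<close> to
  \<open>lam_word\<close> and \<open>rho_word\<close> is legitimate because all letters belong to
  T.\<close>

lemma mult_semidirect:
  assumes "x \<in> lists (T_set A \<D>)" "x' \<in> lists (T_set A \<D>)" "u \<in> lists A" "v \<in> lists A"
  shows "(eta \<V> A \<D> x, word_class u) \<otimes>\<^bsub>semidirect \<V> A \<D>\<^esub> (eta \<V> A \<D> x', word_class v)
       = (eta \<V> A \<D> (map (rho_word v) x @ map (lam_word u) x'), word_class (u @ v))"
proof -
  have in_X: "y \<in> lists (topspace X)" if "y \<in> lists (T_set A \<D>)" for y
    using that T_subset_X lists_mono by blast
  have maps: "map (rho A \<D> (word_class v)) y = map (rho_word v) y"
    "map (lam A \<D> (word_class u)) y = map (lam_word u) y" if "y \<in> lists (T_set A \<D>)" for y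
    using that assms(3,4) by (auto simp: rho_eq_rho_word lam_eq_lam_word in_lists_conv_set)
  have "eta \<V> A \<D> (map (rho_word v) x @ map (lam_word u) x')
      = eta \<V> A \<D> (map (rho_word v) y @ map (lam_word u) y')"
    if "y \<in> lists (T_set A \<D>)" "y' \<in> lists (T_set A \<D>)"
      "eta \<V> A \<D> x = eta \<V> A \<D> y" "eta \<V> A \<D> x' = eta \<V> A \<D> y'" for y y'
    using that assms unfolding eta_def
    by (intro point_class_ext_variety_cong lp_variety continuous_map_rho_word
        continuous_map_lam_word in_X)
  then have "(THE e. \<exists>y\<in>lists (T_set A \<D>). \<exists>y'\<in>lists (T_set A \<D>).
      eta \<V> A \<D> x = eta \<V> A \<D> y \<and> eta \<V> A \<D> x' = eta \<V> A \<D> y' \<and>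
      e = eta \<V> A \<D> (map (rho A \<D> (word_class v)) y @ map (lam A \<D> (word_class u)) y'))
    = eta \<V> A \<D> (map (rho_word v) x @ map (lam_word u) x')"
    using assms(1,2) by (intro the_equality) (metis maps)+
  then show ?thesis
    using assms(3,4) by (simp add: semidirect_def mult_M_word_class)
qed

lemma tau_in_lists:
  assumes "w \<in> lists A"
  shows "tau (D1 A \<D>) w \<in> lists (T_set A \<D>)"
proof -
  have "mark w i \<in> marked A" if "i \<in> set [1..<length w + 1]" for i
  proof -
    have "1 \<le> i" "i \<le> length w" using that by auto
    then show ?thesis using assms unfolding marked_def by blast
  qed
  then show ?thesis by (auto simp: tau_def T_set_def in_lists_conv_set)
qed

lemma tau_snoc:
  assumes "w \<in> lists A" "a \<in> A"
  shows "tau (D1 A \<D>) (w @ [a])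
       = map (rho_word [a]) (tau (D1 A \<D>) w) @ map (lam_word w) [marked_class (mark [a] 1)]"
proof -
  let ?f = "\<lambda>i. marked_class (mark (w @ [a]) i)"
  have rho: "rho_word [a] (marked_class (mark w i)) = ?f i"
    if "i \<in> set [1..<length w + 1]" for i
  proof -
    have "1 \<le> i" "i \<le> length w" using that by auto
    from mark_append_plain[OF this, of "[a]"] show ?thesis
      using assms(2) by (simp add: rho_word_marked_class)
  qed
  have "map (rho_word [a]) (tau (D1 A \<D>) w) = map ?f [1..<length w + 1]"
    unfolding tau_def map_map comp_def by (intro map_cong refl rho)
  \<comment> \<open>The one-letter word carries its mark at position 1; prefixing w moves it to
    \<open>length w + 1\<close>.\<close>
  moreover have "lam_word w (marked_class (mark [a] 1)) = ?f (length w + 1)"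
    using assms(1) by (simp add: lam_word_marked_class plain_append_mark)
  moreover have "[1..<length (w @ [a]) + 1] = [1..<length w + 1] @ [length w + 1]" by simp
  ultimately show ?thesis by (simp only: tau_def[of _ "w @ [a]"] map_append list.map)
qed

lemma hom_eq:
  assumes "h \<in> hom (free_monoid A) (semidirect \<V> A \<D>)" "h [] = \<one>\<^bsub>semidirect \<V> A \<D>\<^esub>"
    and gen: "\<And>a. a \<in> A \<Longrightarrow> h [a] = (eta \<V> A \<D> [marked_class (mark [a] 1)], word_class [a])"
    and "w \<in> lists A"
  shows "h w = (eta \<V> A \<D> (tau (D1 A \<D>) w), word_class w)"
  using assms(4)
proof (induction w rule: rev_induct)
  case Nil
  then show ?case using assms(2) by (simp add: semidirect_def tau_def)
next
  case (snoc a w)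
  then have wa: "w \<in> lists A" "a \<in> A" by auto
  have t: "marked_class (mark [a] 1) \<in> T_set A \<D>"
    using tau_in_lists[of "[a]"] wa(2) by (simp add: tau_def)
  have "h (w @ [a]) = h w \<otimes>\<^bsub>semidirect \<V> A \<D>\<^esub> h [a]"
    using hom_mult[OF assms(1), of w "[a]"] wa by (simp add: free_monoid_def)
  also have "\<dots> = (eta \<V> A \<D> (map (rho_word [a]) (tau (D1 A \<D>) w)
      @ map (lam_word w) [marked_class (mark [a] 1)]), word_class (w @ [a]))"
    unfolding snoc.IH[OF wa(1)] gen[OF wa(2)]
    by (rule mult_semidirect) (use wa t tau_in_lists in auto)
  finally show ?case unfolding tau_snoc[OF wa] .
qed

lemma preimage_box:
  assumes "\<And>w. w \<in> lists A \<Longrightarrow> h w = (eta \<V> A \<D> (tau (D1 A \<D>) w), word_class w)"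
    and "K \<in> ext_variety \<V> X" "L \<in> D0 A \<D>"
  shows "{w \<in> lists A. h w \<in> stone_basic (ext_variety \<V> X) K \<times> stone_basic (D0 A \<D>) L}
       = {w \<in> lists A. tau (D1 A \<D>) w \<in> K} \<inter> L"
proof -
  have iff: "h w \<in> stone_basic (ext_variety \<V> X) K \<times> stone_basic (D0 A \<D>) L
      \<longleftrightarrow> tau (D1 A \<D>) w \<in> K \<and> w \<in> L" if w: "w \<in> lists A" for w
  proof -
    \<comment> \<open>Basic sets contain ultrafilters only, so both components of \<open>h w\<close>
      must be known to be points of the dual spaces.\<close>
    have "eta \<V> A \<D> (tau (D1 A \<D>) w) \<in> ultrafilters (ext_variety \<V> X)"
      unfolding eta_def
      by (rule point_class_in_ultrafilters[OF algebra_ext_variety[OF lp_variety]])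
        (use tau_in_lists[OF w] T_subset_X lists_mono in blast)
    moreover have "word_class w \<in> ultrafilters (D0 A \<D>)"
      by (rule point_class_in_ultrafilters[OF algebra_D0 w])
    moreover have "K \<in> eta \<V> A \<D> (tau (D1 A \<D>) w) \<longleftrightarrow> tau (D1 A \<D>) w \<in> K"
      "L \<in> word_class w \<longleftrightarrow> w \<in> L"
      using assms(2,3) by (simp_all add: eta_def point_class_def)
    ultimately show ?thesis by (simp add: assms(1)[OF w] stone_basic_def)
  qed
  have "{w \<in> lists A. h w \<in> stone_basic (ext_variety \<V> X) K \<times> stone_basic (D0 A \<D>) L}
      = {w \<in> lists A. tau (D1 A \<D>) w \<in> K \<and> w \<in> L}"
    by (rule Collect_cong, rule conj_cong[OF refl], rule iff)
  then show ?thesis using assms(3) by (auto simp: D0_def)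
qed

end

section \<open>Clopen sets against lattice combinations\<close>

theorem theorem6p7:
  fixes A :: "'a set"
    and \<V> :: "nat set \<Rightarrow> nat list set set"
    and \<D> :: "('a \<times> bool) list set set"
    and h :: "'a list \<Rightarrow> ('a \<times> bool) list set set list set set \<times> 'a list set set"
    and L :: "'a list set"
  assumes "finite A"
    and "lp_variety \<V>"
    and "quotient_algebra (A \<times> UNIV) \<D>"
    and "marked A \<in> \<D>"
    and "{K \<inter> Az A | K. K \<in> \<D>} = {{}, Az A}"
    and "h \<in> hom (free_monoid A) (semidirect \<V> A \<D>)"
    and "h [] = \<one>\<^bsub>semidirect \<V> A \<D>\<^esub>"
    and "\<And>a. a \<in> A \<Longrightarrow>
           h [a] = (eta \<V> A \<D> [point_class (D1 A \<D>) (mark [a] 1)], point_class (D0 A \<D>) [a])"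
    and "L \<subseteq> lists A"
  shows "(\<exists>C. openin (prod_topology (stone (ext_variety \<V> (stone (D1 A \<D>)))) (stone (D0 A \<D>))) C \<and>
              closedin (prod_topology (stone (ext_variety \<V> (stone (D1 A \<D>)))) (stone (D0 A \<D>))) C \<and>
              L = {w \<in> lists A. h w \<in> C})
         \<longleftrightarrow> lattice_combination (odot \<V> A (D1 A \<D>) \<union> D0 A \<D>) L"
proof -
  interpret marked_algebra A \<V> \<D> by unfold_locales fact+
  define \<E> where "\<E> = ext_variety \<V> X"
  define \<S> where "\<S> = odot \<V> A (D1 A \<D>) \<union> D0 A \<D>"
  define Z where "Z = prod_topology (stone \<E>) (stone (D0 A \<D>))"
  define clopen where "clopen C \<longleftrightarrow> openin Z C \<and> closedin Z C" for C
  define pre where "pre C = {w \<in> lists A. h w \<in> C}" for C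
  define box where "box = (\<lambda>(K, L). stone_basic \<E> K \<times> stone_basic (D0 A \<D>) L)"
  have algE: "algebra (lists (topspace X)) \<E>"
    unfolding \<E>_def by (rule algebra_ext_variety) fact
  have h: "h w = (eta \<V> A \<D> (tau (D1 A \<D>) w), word_class w)" if "w \<in> lists A" for w
    using assms(6-8) that by (rule hom_eq)
  have pre_box: "pre (box (K, L)) = {w \<in> lists A. tau (D1 A \<D>) w \<in> K} \<inter> L"
    if "K \<in> \<E>" "L \<in> D0 A \<D>" for K L
    using preimage_box[OF h, of K L] that by (simp add: pre_def box_def \<E>_def)
  \<comment> \<open>A box with one of these full factors imposes a condition on the other coordinate
    only, so each generator alone becomes a preimage.\<close>
  have topE: "lists (topspace X) \<in> \<E>" and topD: "lists A \<in> D0 A \<D>"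
    using algebra.top[OF algE] algebra.top[OF algebra_D0] .
  have clopen_box: "clopen (box (K, L))" if "K \<in> \<E>" "L \<in> D0 A \<D>" for K L
    using openin_stone_basic[OF that(1)] openin_stone_basic[OF that(2)]
      closedin_stone_basic[OF algE that(1)] closedin_stone_basic[OF algebra_D0 that(2)]
    by (simp add: clopen_def box_def Z_def openin_prod_Times_iff closedin_prod_Times_iff)
  have "lattice_combination \<S> L" if C: "clopen C" "L = pre C" for C
  proof -
    obtain P where P: "finite P" "P \<subseteq> \<E> \<times> D0 A \<D>" "C = \<Union>(box ` P)"
      using clopen_prod_stone[OF algE algebra_D0, of C] C(1) unfolding clopen_def Z_def box_def by blast
    have "(finite' intersection_of (\<lambda>K. K \<in> \<S>)) (pre (box p))" if "p \<in> P" for p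
    proof -
      obtain K L where p: "p = (K, L)" "K \<in> \<E>" "L \<in> D0 A \<D>" using \<open>p \<in> P\<close> P(2) by blast
      \<comment> \<open>A box contributes an intersection of one language of each kind, so the
        intersected family is nonempty as \<open>finite'\<close> demands.\<close>
      have "pre (box p) = \<Inter>{{w \<in> lists A. tau (D1 A \<D>) w \<in> K}, L}"
        using pre_box[OF p(2,3)] p(1) by simp
      moreover have "{{w \<in> lists A. tau (D1 A \<D>) w \<in> K}, L} \<subseteq> \<S>"
        using p(2,3) by (auto simp: \<S>_def odot_def \<E>_def)
      ultimately show ?thesis
        unfolding intersection_of_def by (intro exI[of _ "{{w \<in> lists A. tau (D1 A \<D>) w \<in> K}, L}"]) auto
    qed
    moreover have "L = \<Union>((pre \<circ> box) ` P)" using C(2) P(3) by (auto simp: pre_def)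
    ultimately show ?thesis
      unfolding lattice_combination_def union_of_def using P(1)
      by (intro exI[of _ "(pre \<circ> box) ` P"]) auto
  qed
  moreover have "\<exists>C. clopen C \<and> L = pre C" if L: "lattice_combination \<S> L"
  proof -
    have gen: "\<exists>C. clopen C \<and> K = pre C" if "K \<in> \<S>" for K
      using that unfolding \<S>_def
    proof
      assume "K \<in> odot \<V> A (D1 A \<D>)"
      then obtain J where J: "J \<in> \<E>" "K = {w \<in> lists A. tau (D1 A \<D>) w \<in> J}"
        by (auto simp: odot_def \<E>_def)
      then have "K = pre (box (J, lists A))" using pre_box[OF J(1) topD] by blast
      then show ?thesis using clopen_box[OF J(1) topD] by blast
    next
      assume K: "K \<in> D0 A \<D>"
      \<comment> \<open>The full first factor excludes no w, because every \<open>tau\<close> word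
        is a word over the dual space of D1.\<close>
      have "tau (D1 A \<D>) w \<in> lists (topspace X)" if "w \<in> lists A" for w
        using tau_in_lists[OF that] T_subset_X lists_mono by blast
      moreover have "K \<subseteq> lists A" using K by (auto simp: D0_def)
      ultimately have "K = pre (box (lists (topspace X), K))" using pre_box[OF topE K] by blast
      then show ?thesis using clopen_box[OF topE K] by blast
    qed
    have inter: "\<exists>C. clopen C \<and> K = pre C" if K: "(finite' intersection_of (\<lambda>K. K \<in> \<S>)) K" for K
    proof -
      obtain \<U> where \<U>: "finite \<U>" "\<U> \<noteq> {}" "\<U> \<subseteq> \<S>" "K = \<Inter>\<U>"
        using K by (auto simp: intersection_of_def)
      obtain c where c: "\<And>U. U \<in> \<U> \<Longrightarrow> clopen (c U) \<and> U = pre (c U)" using gen \<U>(3) by (metis subsetD)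
      have "clopen (\<Inter>(c ` \<U>))"
        using c \<U>(1,2) unfolding clopen_def by (auto intro!: openin_Inter closedin_Inter)
      moreover have "(\<Inter>U\<in>\<U>. pre (c U)) = \<Inter>\<U>" using c by auto
      \<comment> \<open>An empty family would break this equation: the left side would be
        \<open>lists A\<close>, while the intersection of no languages is
        \<open>UNIV\<close>.\<close>
      moreover have "pre (\<Inter>(c ` \<U>)) = (\<Inter>U\<in>\<U>. pre (c U))" using \<U>(2) by (auto simp: pre_def)
      ultimately show ?thesis using \<U>(4) by metis
    qed
    obtain \<U> where \<U>: "finite \<U>" "\<And>U. U \<in> \<U> \<Longrightarrow> (finite' intersection_of (\<lambda>K. K \<in> \<S>)) U" "L = \<Union>\<U>"
      using L by (auto simp: lattice_combination_def union_of_def)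
    obtain c where c: "\<And>U. U \<in> \<U> \<Longrightarrow> clopen (c U) \<and> U = pre (c U)" using inter \<U>(2) by metis
    have "clopen (\<Union>(c ` \<U>))"
      using c \<U>(1) unfolding clopen_def by (auto intro!: openin_Union closedin_Union)
    moreover have "(\<Union>U\<in>\<U>. pre (c U)) = \<Union>\<U>" using c by auto
    moreover have "pre (\<Union>(c ` \<U>)) = (\<Union>U\<in>\<U>. pre (c U))" by (auto simp: pre_def)
    ultimately show ?thesis using \<U>(3) by metis
  qed
  ultimately show ?thesis
    unfolding clopen_def Z_def pre_def \<S>_def \<E>_def by blast
qed

end
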